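(* Suppose that the matrices $P(t)$ are given by $P(t)=P(G(t))$, where $G'\mapsto P(G')$ is a map assigning to each spanning subgraph $G'=(V,E')\in\mathcal{S}(G)$ a real $n\times n$ matrix $P(G')=(p_{ij}(G'))$ such that: (i) $p_{ij}(G')\in[0,1]$ for all $i,j\in V$, $\sum_{j=1}^n p_{ij}(G')=1$ for all $i\in V$, and $p_{ij}(G')\ne 0$ if and only if $j=i$ or $(i,j)\in E'$; (ii) $P(G')$ is invertible; (iii) $\sum_{i=1}^n p_{ij}(G')=1$ for all $j\in V$. Then for almost all (with respect to Lebesgue measure on $\mathbb{R}^n$) vectors of initial opinions $x^0\in\mathbb{R}^n$, the following holds: any two agents $i,j\in V$ asymptotically agree if and only if they are asymptotically connected.
   Context: Opinion dynamics with decaying confidence. Let $V=\{1,\dots,n\}$ be a finite set of agents and $E\subseteq V\times V$ a symmetric, anti-reflexive relation, so that $G=(V,E)$ is an undirected graph. $\mathcal{S}(G)$ denotes the (finite) set of spanning subgraphs $G'=(V,E')$ of $G$, with $E'\subseteq E$ symmetric. Let $R>0$ and $\rho\in(0,1)$ be parameters. Given a vector of initial opinions $x^0\in\mathbb{R}^n$, the vector of opinions $x(t)=(x_1(t),\dots,x_n(t))^\top$, $t\in\mathbb{N}=\{0,1,2,\dots\}$, is defined by $x(0)=x^0$ and $$x(t+1)=P(t)x(t),\qquad P(t)=P(G(t)),$$ where $G(t)=(V,E(t))$ is the interaction graph at time $t$, with $$E(t)=\{(i,j)\in E\mid |x_i(t)-x_j(t)|\le R\rho^t\}$$ (so $G(t)$,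 and hence $P(t)$, depends on $x(t)$ and $t$). Under condition (i), each sequence $(x_i(t))_{t\in\mathbb{N}}$ converges; its limit is denoted $x_i^*$. Agents $i,j$ asymptotically agree if $x_i^*=x_j^*$. Let $E^\infty=\{(i,j)\in E\mid \forall t\in\mathbb{N},\ \exists s\ge t,\ (i,j)\in E(s)\}$ and $G^\infty=(V,E^\infty)$ (depending on $x^0$). Agents $i,j$ are asymptotically connected if they are connected by a path in $G^\infty$ (a vertex being regarded as connected to itself). *)

theory Defs
  imports "HOL-Analysis.Analysis"
begin

text \<open>
  The agents are the elements of a finite type \<open>'n\<close>, and a graph on all agents is given by its
  edge set, a symmetric relation; undirected edges occur in both orientations.
\<close>

definition spanning_subgraphs :: "'n rel \<Rightarrow> 'n rel set" where
  "spanning_subgraphs E = {E'. E' \<subseteq> E \<and> sym E'}"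

definition interaction_edges ::
    "'n::finite rel \<Rightarrow> real \<Rightarrow> real \<Rightarrow> nat \<Rightarrow> real ^ 'n \<Rightarrow> 'n rel" where
  "interaction_edges E R \<rho> t x = {(i, j) \<in> E. \<bar>x $ i - x $ j\<bar> \<le> R * \<rho> ^ t}"

primrec opinions ::
    "'n::finite rel \<Rightarrow> real \<Rightarrow> real \<Rightarrow> ('n rel \<Rightarrow> real ^ 'n ^ 'n) \<Rightarrow> real ^ 'n \<Rightarrow> nat \<Rightarrow> real ^ 'n" where
  "opinions E R \<rho> P x0 0 = x0"
| "opinions E R \<rho> P x0 (Suc t) =
     P (interaction_edges E R \<rho> t (opinions E R \<rho> P x0 t)) *v opinions E R \<rho> P x0 t"

text \<open>
  The limit below is meaningful when every matrix \<open>P E'\<close> is row-stochastic with positive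
  off-diagonal entries exactly on \<open>E'\<close>; see \<open>opinions_convergent\<close> at the end of this theory.
\<close>

definition limit_opinion ::
    "'n::finite rel \<Rightarrow> real \<Rightarrow> real \<Rightarrow> ('n rel \<Rightarrow> real ^ 'n ^ 'n) \<Rightarrow> real ^ 'n \<Rightarrow> 'n \<Rightarrow> real" where
  "limit_opinion E R \<rho> P x0 i = lim (\<lambda>t. opinions E R \<rho> P x0 t $ i)"

definition asymptotically_agree ::
    "'n::finite rel \<Rightarrow> real \<Rightarrow> real \<Rightarrow> ('n rel \<Rightarrow> real ^ 'n ^ 'n) \<Rightarrow> real ^ 'n \<Rightarrow> 'n \<Rightarrow> 'n \<Rightarrow> bool" where
  "asymptotically_agree E R \<rho> P x0 i j \<longleftrightarrow>
     limit_opinion E R \<rho> P x0 i = limit_opinion E R \<rho> P x0 j"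

definition limit_edges ::
    "'n::finite rel \<Rightarrow> real \<Rightarrow> real \<Rightarrow> ('n rel \<Rightarrow> real ^ 'n ^ 'n) \<Rightarrow> real ^ 'n \<Rightarrow> 'n rel" where
  "limit_edges E R \<rho> P x0 =
     {(i, j) \<in> E. \<forall>t. \<exists>s\<ge>t. (i, j) \<in> interaction_edges E R \<rho> s (opinions E R \<rho> P x0 s)}"

definition asymptotically_connected ::
    "'n::finite rel \<Rightarrow> real \<Rightarrow> real \<Rightarrow> ('n rel \<Rightarrow> real ^ 'n ^ 'n) \<Rightarrow> real ^ 'n \<Rightarrow> 'n \<Rightarrow> 'n \<Rightarrow> bool" where
  "asymptotically_connected E R \<rho> P x0 i j \<longleftrightarrow> (i, j) \<in> (limit_edges E R \<rho> P x0)\<^sup>*"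

lemma interaction_edges_spanning:
  assumes "sym E"
  shows "interaction_edges E R \<rho> t x \<in> spanning_subgraphs E"
  using assms
  by (auto simp: spanning_subgraphs_def interaction_edges_def sym_def abs_minus_commute)

lemma opinions_convergent:
  fixes P :: "'n::finite rel \<Rightarrow> real ^ 'n ^ 'n"
  assumes "sym E" and "R > 0" and rho: "0 < \<rho>" "\<rho> < 1"
    and range: "\<And>E' i j. E' \<in> spanning_subgraphs E \<Longrightarrow> P E' $ i $ j \<in> {0..1}"
    and rows: "\<And>E' i. E' \<in> spanning_subgraphs E \<Longrightarrow> (\<Sum>j\<in>UNIV. P E' $ i $ j) = 1"
    and support: "\<And>E' i j. E' \<in> spanning_subgraphs E \<Longrightarrow>
                    P E' $ i $ j \<noteq> 0 \<longleftrightarrow> j = i \<or> (i, j) \<in> E'"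
  shows "convergent (\<lambda>t. opinions E R \<rho> P x0 t $ i)"
proof -
  define x where "x = opinions E R \<rho> P x0"
  have step: "norm (x (Suc t) $ i - x t $ i) \<le> R * \<rho> ^ t" for t
  proof -
    define E' where "E' = interaction_edges E R \<rho> t (x t)"
    have E': "E' \<in> spanning_subgraphs E"
      unfolding E'_def by (rule interaction_edges_spanning) fact
    have "x (Suc t) $ i - x t $ i
        = (\<Sum>j\<in>UNIV. P E' $ i $ j * x t $ j) - (\<Sum>j\<in>UNIV. P E' $ i $ j) * x t $ i"
      by (simp add: x_def E'_def matrix_vector_mult_def rows[OF E', unfolded E'_def x_def])
    also have "\<dots> = (\<Sum>j\<in>UNIV. P E' $ i $ j * (x t $ j - x t $ i))"
      by (simp add: sum_distrib_right sum_subtractf right_diff_distrib)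
    finally have "norm (x (Suc t) $ i - x t $ i)
        \<le> (\<Sum>j\<in>UNIV. norm (P E' $ i $ j * (x t $ j - x t $ i)))"
      by (simp add: norm_sum del: real_norm_def)
    also have "\<dots> \<le> (\<Sum>j\<in>UNIV. P E' $ i $ j * (R * \<rho> ^ t))"
    proof (rule sum_mono)
      fix j
      show "norm (P E' $ i $ j * (x t $ j - x t $ i)) \<le> P E' $ i $ j * (R * \<rho> ^ t)"
      proof (cases "P E' $ i $ j = 0")
        case False
        then have "j = i \<or> (i, j) \<in> E'"
          using support[OF E'] by blast
        then have "\<bar>x t $ j - x t $ i\<bar> \<le> R * \<rho> ^ t"
          using \<open>R > 0\<close> rho by (auto simp: E'_def interaction_edges_def abs_minus_commute)
        then show ?thesis
          using range[OF E', of i j] by (simp add: abs_mult mult_left_mono)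
      qed simp
    qed
    also have "\<dots> = R * \<rho> ^ t"
      using rows[OF E', of i] by (simp flip: sum_distrib_right)
    finally show ?thesis .
  qed
  have "summable (\<lambda>t. x (Suc t) $ i - x t $ i)"
    by (rule summable_comparison_test'[where g = "\<lambda>t. R * \<rho> ^ t" and N = 0])
      (use step rho in \<open>auto intro!: summable_mult summable_geometric\<close>)
  then have "convergent (\<lambda>n. \<Sum>t<n. x (Suc t) $ i - x t $ i)"
    by (simp add: summable_iff_convergent)
  then have "convergent (\<lambda>n. x n $ i - x 0 $ i)"
    by (simp add: sum_lessThan_telescope[where f = "\<lambda>t. x t $ i"])
  then have "convergent (\<lambda>n. (x n $ i - x 0 $ i) + x 0 $ i)"
    by (intro convergent_add convergent_const)
  then show ?thesis
    by (simp add: x_def)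
qed

end

theory Submission
  imports Defs
begin

text \<open>
  Asymptotically connected agents agree because an edge that is active infinitely often confines the
  opinions at its ends to a distance \<open>R * \<rho> ^ t\<close> for arbitrarily large \<open>t\<close>
  (\<open>limit_opinion_eq_if_connected\<close>).

  Conversely, the edges that are active only finitely often have all disappeared after some time
  \<open>T\<close>. From then on no component of the limit graph interacts with the others, so, the matrices
  being doubly stochastic, the sum of the opinions in each component is conserved
  (\<open>sum_matrix_vector_mult_invariant_set\<close>). The members of a component have a common limit, which is
  therefore the mean over the component of the opinions at time \<open>T\<close> (\<open>limit_opinion_eq_mean\<close>). If
  agents in different components agree, then two nonempty disjoint sets of agents have the same mean
  opinion at time \<open>T\<close>, that is, the opinion vector at time \<open>T\<close> lies in a certain hyperplane.

  The opinion vector at time \<open>T\<close> depends nonlinearly on the initial one, but only through the choice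
  of the graphs: it is the image of \<open>x0\<close> under one of finitely many products of \<open>T\<close> of the
  matrices. These products are invertible, so each of them pulls the hyperplane back to a hyperplane.
  The exceptional initial opinions are thus covered by countably many hyperplanes: there are
  countably many times, and for each of them finitely many products and pairs of sets of agents.
\<close>

section \<open>Limits in the components of the limit graph\<close>

lemma sym_limit_edges:
  assumes "sym E"
  shows "sym (limit_edges E R \<rho> P x0)"
  using assms
  by (fastforce simp: sym_def limit_edges_def interaction_edges_def abs_minus_commute)

text \<open>
  Opinions within \<open>R * \<rho> ^ t\<close> of each other at arbitrarily large times \<open>t\<close> have the same limit; this
  propagates along paths.
\<close>

lemma limit_opinion_eq_if_connected:
  fixes P :: "'n::finite rel \<Rightarrow> real ^ 'n ^ 'n"
  assumes rho: "0 < \<rho>" "\<rho> < 1"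
    and lim: "\<And>k. (\<lambda>t. opinions E R \<rho> P x0 t $ k) \<longlonglongrightarrow> limit_opinion E R \<rho> P x0 k"
    and "(i, j) \<in> (limit_edges E R \<rho> P x0)\<^sup>*"
  shows "limit_opinion E R \<rho> P x0 i = limit_opinion E R \<rho> P x0 j"
  using assms(4)
proof induction
  case (step j k)
  let ?x = "opinions E R \<rho> P x0"
  let ?gap = "\<lambda>t. \<bar>?x t $ j - ?x t $ k\<bar> - R * \<rho> ^ t"
  let ?limit_gap = "\<bar>limit_opinion E R \<rho> P x0 j - limit_opinion E R \<rho> P x0 k\<bar>"
  have "?gap \<longlonglongrightarrow> ?limit_gap - R * 0"
    using rho by (intro tendsto_intros lim LIMSEQ_realpow_zero) auto
  moreover have "\<exists>\<^sub>F t in sequentially. ?gap t \<le> 0"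
    unfolding frequently_sequentially
    using step.hyps(2) by (fastforce simp: limit_edges_def interaction_edges_def)
  ultimately have "\<not> 0 < ?limit_gap - R * 0"
    using order_tendstoD(1) unfolding frequently_def not_le by blast
  then show ?case
    using step.IH by simp
qed simp

lemma eventually_interaction_edges_subset_limit_edges:
  fixes P :: "'n::finite rel \<Rightarrow> real ^ 'n ^ 'n"
  shows "\<exists>T. \<forall>t\<ge>T. interaction_edges E R \<rho> t (opinions E R \<rho> P x0 t) \<subseteq> limit_edges E R \<rho> P x0"
proof -
  let ?E = "\<lambda>t. interaction_edges E R \<rho> t (opinions E R \<rho> P x0 t)"
  have "\<forall>\<^sub>F t in sequentially. e \<notin> ?E t" if "e \<notin> limit_edges E R \<rho> P x0" for e
    using that unfolding eventually_sequentially
    by (cases e) (auto simp: limit_edges_def interaction_edges_def)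
  then have "\<forall>\<^sub>F t in sequentially. \<forall>e\<in>- limit_edges E R \<rho> P x0. e \<notin> ?E t"
    by (intro eventually_ball_finite) auto
  then show ?thesis
    unfolding eventually_sequentially by blast
qed

text \<open>
  If no nonzero entry links \<open>C\<close> with its complement, then the columns over \<open>C\<close> already sum to one
  within \<open>C\<close>, and those outside \<open>C\<close> contribute nothing.
\<close>

lemma sum_matrix_vector_mult_invariant_set:
  fixes A :: "'a::comm_semiring_1 ^ 'n::finite ^ 'n"
  assumes cols: "\<And>j. (\<Sum>i\<in>UNIV. A $ i $ j) = 1"
    and block: "\<And>i j. A $ i $ j \<noteq> 0 \<Longrightarrow> i \<in> C \<longleftrightarrow> j \<in> C"
  shows "(\<Sum>i\<in>C. (A *v x) $ i) = (\<Sum>i\<in>C. x $ i)"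
proof -
  have col: "(\<Sum>i\<in>C. A $ i $ j) = (if j \<in> C then 1 else 0)" for j
  proof (cases "j \<in> C")
    case True
    then have "(\<Sum>i\<in>C. A $ i $ j) = (\<Sum>i\<in>UNIV. A $ i $ j)"
      using block by (intro sum.mono_neutral_left) auto
    then show ?thesis
      using cols True by simp
  next
    case False
    then show ?thesis
      using block by (auto intro!: sum.neutral)
  qed
  have "(\<Sum>i\<in>C. (A *v x) $ i) = (\<Sum>j\<in>UNIV. (\<Sum>i\<in>C. A $ i $ j) * x $ j)"
    by (simp add: matrix_vector_mult_def sum_distrib_right sum.swap[of _ _ C])
  also have "\<dots> = (\<Sum>j\<in>UNIV. if j \<in> C then x $ j else 0)"
    by (intro sum.cong) (auto simp: col)
  also have "\<dots> = (\<Sum>i\<in>C. x $ i)"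
    by (simp add: sum.If_cases)
  finally show ?thesis .
qed

text \<open>
  The component of \<open>i\<close> in the limit graph is isolated from time \<open>T\<close> on, so its total opinion stays
  what it was at time \<open>T\<close>, while its members approach one and the same value.
\<close>

lemma limit_opinion_eq_mean:
  fixes P :: "'n::finite rel \<Rightarrow> real ^ 'n ^ 'n" and i :: 'n
  assumes "sym E" and rho: "0 < \<rho>" "\<rho> < 1"
    and lim: "\<And>k. (\<lambda>t. opinions E R \<rho> P x0 t $ k) \<longlonglongrightarrow> limit_opinion E R \<rho> P x0 k"
    and support: "\<And>E' i j. E' \<in> spanning_subgraphs E \<Longrightarrow>
                    P E' $ i $ j \<noteq> 0 \<Longrightarrow> j = i \<or> (i, j) \<in> E'"
    and cols: "\<And>E' j. E' \<in> spanning_subgraphs E \<Longrightarrow> (\<Sum>i\<in>UNIV. P E' $ i $ j) = 1"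
    and late: "\<And>t. t \<ge> T \<Longrightarrow>
                 interaction_edges E R \<rho> t (opinions E R \<rho> P x0 t) \<subseteq> limit_edges E R \<rho> P x0"
  defines "C \<equiv> {k. (i, k) \<in> (limit_edges E R \<rho> P x0)\<^sup>*}"
  shows "limit_opinion E R \<rho> P x0 i = (\<Sum>k\<in>C. opinions E R \<rho> P x0 T $ k) / card C"
proof -
  let ?x = "opinions E R \<rho> P x0"
  let ?E = "\<lambda>t. interaction_edges E R \<rho> t (?x t)"
  let ?L = "limit_edges E R \<rho> P x0"
  have conserved: "(\<Sum>k\<in>C. ?x t $ k) = (\<Sum>k\<in>C. ?x T $ k)" if "t \<ge> T" for t
    using that
  proof (induction rule: dec_induct)
    case (step t)
    have E': "?E t \<in> spanning_subgraphs E"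
      by (rule interaction_edges_spanning) fact
    have "k \<in> C \<longleftrightarrow> l \<in> C" if "P (?E t) $ k $ l \<noteq> 0" for k l
    proof -
      have "l = k \<or> (k, l) \<in> ?L \<and> (l, k) \<in> ?L"
        using support[OF E' that] late[OF step.hyps(1)] sym_limit_edges[OF \<open>sym E\<close>]
        by (meson subsetD symD)
      then show ?thesis
        by (auto simp: C_def intro: rtrancl_into_rtrancl)
    qed
    then show ?case
      using step.IH sum_matrix_vector_mult_invariant_set[OF cols[OF E'], of C "?x t"] by simp
  qed simp
  have "(\<lambda>t. \<Sum>k\<in>C. ?x t $ k) \<longlonglongrightarrow> (\<Sum>k\<in>C. limit_opinion E R \<rho> P x0 k)"
    by (intro tendsto_sum lim)
  moreover have "(\<lambda>t. \<Sum>k\<in>C. ?x t $ k) \<longlonglongrightarrow> (\<Sum>k\<in>C. ?x T $ k)"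
    by (intro tendsto_eventually eventually_sequentiallyI[of T] conserved)
  ultimately have "(\<Sum>k\<in>C. ?x T $ k) = (\<Sum>k\<in>C. limit_opinion E R \<rho> P x0 k)"
    by (rule LIMSEQ_unique[rotated])
  also have "\<dots> = (\<Sum>k\<in>C. limit_opinion E R \<rho> P x0 i)"
    using limit_opinion_eq_if_connected[OF rho lim, of i] by (intro sum.cong) (auto simp: C_def)
  also have "\<dots> = card C * limit_opinion E R \<rho> P x0 i"
    by simp
  finally have "(\<Sum>k\<in>C. ?x T $ k) = card C * limit_opinion E R \<rho> P x0 i" .
  moreover have "i \<in> C"
    by (simp add: C_def)
  then have "card C \<noteq> 0"
    by (auto simp: card_eq_0_iff)
  ultimately show ?thesis
    by simp
qed

section \<open>Exceptional initial opinions\<close>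

primrec matrix_products :: "(real ^ 'n ^ 'n) set \<Rightarrow> nat \<Rightarrow> (real ^ 'n::finite ^ 'n) set" where
  "matrix_products \<A> 0 = {mat 1}"
| "matrix_products \<A> (Suc t) = (\<lambda>(A, M). A ** M) ` (\<A> \<times> matrix_products \<A> t)"

lemma finite_matrix_products: "finite \<A> \<Longrightarrow> finite (matrix_products \<A> t)"
  by (induction t) auto

lemma invertible_matrix_products:
  assumes "\<And>A. A \<in> \<A> \<Longrightarrow> invertible A" and "M \<in> matrix_products \<A> t"
  shows "invertible M"
  using assms(2)
proof (induction t arbitrary: M)
  case 0
  then show ?case
    by (auto simp: invertible_def intro: exI[of _ "mat 1"])
qed (auto intro: assms(1) invertible_mult)

text \<open>
  Which product it is depends on \<open>x0\<close>, but the finitely many candidates do not; this is what confines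
  the exceptional initial opinions to countably many hyperplanes.
\<close>

lemma opinions_eq_matrix_product:
  assumes "sym E"
  shows "\<exists>M\<in>matrix_products (P ` spanning_subgraphs E) t. opinions E R \<rho> P x0 t = M *v x0"
proof (induction t)
  case (Suc t)
  then show ?case
    using interaction_edges_spanning[OF assms, of R \<rho> t "opinions E R \<rho> P x0 t"]
    by (fastforce simp: matrix_vector_mul_assoc)
qed simp

text \<open>
  Equality of the two means is a single linear equation \<open>a \<bullet> (M *v x) = 0\<close>. Disjointness makes \<open>a\<close>
  nonzero, and invertibility of \<open>M\<close> keeps the pulled-back normal vector \<open>a v* M\<close> nonzero.
\<close>

lemma negligible_equal_means_after_invertible:
  fixes M :: "real ^ 'n::finite ^ 'n" and A B :: "'n set"
  assumes "invertible M" and "A \<noteq> {}" and "A \<inter> B = {}"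
  shows "negligible {x. (\<Sum>k\<in>A. (M *v x) $ k) / card A = (\<Sum>k\<in>B. (M *v x) $ k) / card B}"
proof -
  define a :: "real ^ 'n" where
    "a = (\<chi> k. (if k \<in> A then 1 / card A else 0) - (if k \<in> B then 1 / card B else 0))"
  have "a \<bullet> y = (\<Sum>k\<in>A. y $ k) / card A - (\<Sum>k\<in>B. y $ k) / card B" for y
  proof -
    have "a \<bullet> y = (\<Sum>k\<in>UNIV. (if k \<in> A then y $ k / card A else 0)
                             - (if k \<in> B then y $ k / card B else 0))"
      unfolding inner_vec_def a_def by (intro sum.cong) (auto simp: algebra_simps)
    then show ?thesis
      by (simp add: sum_subtractf sum.If_cases sum_divide_distrib)
  qed
  then have "{x. (\<Sum>k\<in>A. (M *v x) $ k) / card A = (\<Sum>k\<in>B. (M *v x) $ k) / card B}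
      = {x. (a v* M) \<bullet> x = 0}"
    by (simp add: dot_lmul_matrix)
  moreover
  have "a \<noteq> 0"
  proof -
    from \<open>A \<noteq> {}\<close> obtain k where "k \<in> A" by blast
    then have "a $ k = 1 / card A" and "card A \<noteq> 0"
      using \<open>A \<inter> B = {}\<close> by (auto simp: a_def card_eq_0_iff)
    then show ?thesis
      by auto
  qed
  have "a v* M \<noteq> 0"
  proof
    assume "a v* M = 0"
    obtain B' where "M ** B' = mat 1"
      using \<open>invertible M\<close> by (auto simp: invertible_def)
    then have "a \<bullet> a = (a v* M) \<bullet> (B' *v a)"
      by (simp add: dot_lmul_matrix matrix_vector_mul_assoc)
    with \<open>a v* M = 0\<close> \<open>a \<noteq> 0\<close> show False
      by simp
  qed
  ultimately show ?thesis
    by (simp add: negligible_hyperplane)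
qed

theorem theorem1:
  fixes E :: "'n::finite rel"
    and R \<rho> :: real
    and P :: "'n rel \<Rightarrow> real ^ 'n ^ 'n"
  assumes "sym E" and "irrefl E"
    and "R > 0" and "0 < \<rho>" and "\<rho> < 1"
    and "\<And>E' i j. E' \<in> spanning_subgraphs E \<Longrightarrow> P E' $ i $ j \<in> {0..1}"
    and "\<And>E' i. E' \<in> spanning_subgraphs E \<Longrightarrow> (\<Sum>j\<in>UNIV. P E' $ i $ j) = 1"
    and "\<And>E' i j. E' \<in> spanning_subgraphs E \<Longrightarrow>
           P E' $ i $ j \<noteq> 0 \<longleftrightarrow> j = i \<or> (i, j) \<in> E'"
    and "\<And>E'. E' \<in> spanning_subgraphs E \<Longrightarrow> invertible (P E')"
    and "\<And>E' j. E' \<in> spanning_subgraphs E \<Longrightarrow> (\<Sum>i\<in>UNIV. P E' $ i $ j) = 1"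
  shows "AE x0 in lebesgue. \<forall>i j.
           asymptotically_agree E R \<rho> P x0 i j \<longleftrightarrow> asymptotically_connected E R \<rho> P x0 i j"
proof -
  define Ms where "Ms = matrix_products (P ` spanning_subgraphs E)"
  define hyperplane where "hyperplane M A B =
    {x. (\<Sum>k\<in>A. (M *v x) $ k) / card A = (\<Sum>k\<in>B. (M *v x) $ k) / card B}"
    for M :: "real ^ 'n ^ 'n" and A B :: "'n set"
  define exceptional where
    "exceptional = (\<Union>t. \<Union>(M, A, B)\<in>Ms t \<times> {(A, B). A \<noteq> {} \<and> A \<inter> B = {}}. hyperplane M A B)"
  have inv: "invertible M" if "M \<in> Ms t" for M t
    using that unfolding Ms_def by (rule invertible_matrix_products[rotated]) (auto intro: assms(9))
  have fin: "finite (Ms t)" for t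
    unfolding Ms_def by (intro finite_matrix_products finite_imageI) simp
  have "negligible exceptional"
    unfolding exceptional_def
  proof (rule negligible_Union_nat, rule negligible_Union)
    fix t S
    assume "S \<in> (\<lambda>(M, A, B). hyperplane M A B) ` (Ms t \<times> {(A, B). A \<noteq> {} \<and> A \<inter> B = {}})"
    then show "negligible S"
      unfolding hyperplane_def by (auto intro: negligible_equal_means_after_invertible inv)
  qed (use fin in simp)
  have "asymptotically_agree E R \<rho> P x0 i j \<longleftrightarrow> asymptotically_connected E R \<rho> P x0 i j"
    if "x0 \<notin> exceptional" for x0 i j
  proof -
    let ?x = "opinions E R \<rho> P x0"
    let ?L = "limit_edges E R \<rho> P x0"
    let ?C = "\<lambda>i. {k. (i, k) \<in> ?L\<^sup>*}"
    have lim: "(\<lambda>t. ?x t $ k) \<longlonglongrightarrow> limit_opinion E R \<rho> P x0 k" for k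
      using opinions_convergent[OF assms(1,3-8)] by (simp add: limit_opinion_def convergent_LIMSEQ_iff)
    have "limit_opinion E R \<rho> P x0 i \<noteq> limit_opinion E R \<rho> P x0 j" if "(i, j) \<notin> ?L\<^sup>*"
    proof
      assume agree: "limit_opinion E R \<rho> P x0 i = limit_opinion E R \<rho> P x0 j"
      obtain T where late: "\<And>t. t \<ge> T \<Longrightarrow> interaction_edges E R \<rho> t (?x t) \<subseteq> ?L"
        using eventually_interaction_edges_subset_limit_edges by meson
      have mean: "limit_opinion E R \<rho> P x0 k = (\<Sum>l\<in>?C k. ?x T $ l) / card (?C k)" for k
        by (rule limit_opinion_eq_mean[OF assms(1,4,5) lim _ assms(10) late]) (simp_all add: assms(8))
      obtain M where M: "M \<in> Ms T" "?x T = M *v x0"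
        unfolding Ms_def using opinions_eq_matrix_product[OF assms(1)] by blast
      have "x0 \<in> hyperplane M (?C i) (?C j)"
        using agree mean[of i] mean[of j] M(2) by (simp add: hyperplane_def)
      moreover have "?C i \<inter> ?C j = {}"
        using that symD[OF sym_rtrancl[OF sym_limit_edges[OF assms(1)]]]
        by (blast intro: rtrancl_trans)
      moreover have "?C i \<noteq> {}"
        by blast
      ultimately have "x0 \<in> exceptional"
        unfolding exceptional_def using M(1)
        by (intro UN_I[of T] UN_I[of "(M, ?C i, ?C j)"]) auto
      with \<open>x0 \<notin> exceptional\<close> show False ..
    qed
    then show ?thesis
      using limit_opinion_eq_if_connected[OF assms(4,5) lim]
      unfolding asymptotically_agree_def asymptotically_connected_def by blast
  qed
  then show ?thesis
    using \<open>negligible exceptional\<close> by (intro AE_I'[of exceptional]) (auto simp: negligible_iff_null_sets)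
qed

end
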